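(* Let $ABC$ be a (nondegenerate) triangle in the Euclidean plane, let $r,s,t$ be independent random variables uniformly distributed on $[0,1]$, and let $R = B + r\,\overrightarrow{BC}$, $S = C + s\,\overrightarrow{CA}$, $T = A + t\,\overrightarrow{AB}$. Let $Q = |\Delta RST|/|\Delta ABC|$, and let $\mathrm{PDF}(c) = \frac{d}{dc}P(Q\le c)$ be its probability density function. Then $$\mathrm{PDF}(c) = \begin{cases} -3\ln c-6\sqrt{1-4c}\,\tanh^{-1}\sqrt{1-4c}, & 0\le c< \frac14,\\[2pt] 3\ln 4, & c=\frac14,\\[2pt] -3\ln c+2\sqrt{4c-1}\left(-\pi+3\tan^{-1}\sqrt{4c-1}\right), & \frac14< c\le 1,\end{cases}$$ where at $c=0$ the right-hand side is understood as its limit as $c\to 0^+$.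
   Context: $|\Delta XYZ|$ denotes the signed area of the triangle $XYZ$ (sign determined by the orientation of the ordered triple of vertices). One has $Q = Q(r,s,t) = rst+(1-r)(1-s)(1-t)$, and $P(Q\le c)$ is the volume of $\{(r,s,t)\in[0,1]^3 : Q(r,s,t)\le c\}$. At the endpoints $c=0$ and $c=1$ the derivative may be taken as a one-sided derivative from within $[0,1]$. $\ln$ is the natural logarithm, $\tanh^{-1}$ is the inverse hyperbolic tangent on $(-1,1)$, $\tanh^{-1}(a)=\frac12\ln\frac{1+a}{1-a}$, and $\tan^{-1}$ is the principal branch of the arctangent. *)

theory Defs
  imports "HOL-Probability.Probability"
begin

text \<open>Positive when \<open>X\<close>, \<open>Y\<close>, \<open>Z\<close> are in counterclockwise order.\<close>

definition signed_area :: "real ^ 2 \<Rightarrow> real ^ 2 \<Rightarrow> real ^ 2 \<Rightarrow> real" where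
  "signed_area X Y Z =
     ((Y $ 1 - X $ 1) * (Z $ 2 - X $ 2) - (Z $ 1 - X $ 1) * (Y $ 2 - X $ 2)) / 2"

lemma abs_signed_area: "\<bar>signed_area X Y Z\<bar> = measure lborel (convex hull {X, Y, Z})"
  by (subst content_triangle) (simp add: signed_area_def abs_minus_commute)

text \<open>Meant for \<open>0 < c\<close> and \<open>c \<le> 1\<close>: HOL's \<open>ln 0\<close> and \<open>artanh 1\<close> are dummy
  values, so the value at 0 is not the limit from the right.\<close>

definition area_ratio_density :: "real \<Rightarrow> real" where
  "area_ratio_density c =
     (if c < 1 / 4 then - 3 * ln c - 6 * sqrt (1 - 4 * c) * artanh (sqrt (1 - 4 * c))
      else if c = 1 / 4 then 3 * ln 4
      else - 3 * ln c + 2 * sqrt (4 * c - 1) * (- pi + 3 * arctan (sqrt (4 * c - 1))))"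

end

theory Submission
  imports Defs "HOL-Real_Asymp.Real_Asymp"
begin

text \<open>
  Multilinearity of the area gives \<open>Q = r * s * t + (1 - r) * (1 - s) * (1 - t)\<close>. For fixed \<open>r\<close>
  and \<open>s\<close> this is affine in \<open>t\<close> with slope \<open>r + s - 1\<close>, so \<open>Q\<close> is then uniform between
  \<open>(1 - r) * (1 - s)\<close> and \<open>r * s\<close>. By Tonelli, \<open>Q\<close> has as density at \<open>x\<close> the integral of
  \<open>1 / \<bar>r + s - 1\<bar>\<close> over those \<open>(r, s)\<close> for which \<open>x\<close> lies between these two values
  (\<open>nn_integral_cube\<close>). The symmetry \<open>(r, s) \<mapsto> (1 - r, 1 - s)\<close> reduces this to twice the part
  with \<open>1 < r + s\<close> (\<open>conditional_density_split\<close>).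

  The order of integration matters. Integrating over \<open>s\<close> first gives only logarithms: with
  \<open>w = r * (1 - r)\<close> the result is \<open>ln (w / (w - x))\<close> or \<open>ln (r\<^sup>2 / (x - w))\<close>, according to the
  sign of \<open>w - x\<close>, for \<open>x \<le> r \<le> 1\<close> (\<open>nn_integral_ascending_kernel_slice\<close>). The remaining
  integral over \<open>r\<close> is governed by the roots of \<open>r\<^sup>2 - r + x\<close>. For \<open>x < 1 / 4\<close> they are real, say
  \<open>a\<close> and \<open>b\<close>, and the density is \<open>- 6 * (a * ln a + b * ln b)\<close>, which is the claimed formula in
  disguise (\<open>has_integral_ascending_density_small\<close>, \<open>extended_density_eq\<close>); for \<open>1 / 4 < x\<close> they are
  complex and an arctangent appears (\<open>has_integral_ascending_density_large\<close>).

  The density so obtained extends continuously to \<open>[0, 1]\<close>, with value 0 at 0. Hence the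
  distribution function is the indefinite integral of a continuous function, and the fundamental
  theorem of calculus gives the derivative at every point, including \<open>1 / 4\<close> and both endpoints.
\<close>

section \<open>Logarithmic integrals\<close>

lemma has_real_derivative_ln_nonzero:
  fixes y :: real
  assumes "y \<noteq> 0"
  shows "(ln has_real_derivative 1 / y) (at y)"
proof (cases "y > 0")
  case True
  then show ?thesis by (rule DERIV_ln_divide)
next
  case False
  then have "((\<lambda>u. ln (- u)) has_real_derivative 1 / y) (at y)"
    using assms by (auto intro!: derivative_eq_intros)
  then show ?thesis by (simp add: ln_minus)
qed

lemma continuous_mult_ln: "continuous_on UNIV (\<lambda>y::real. y * ln y)"
  unfolding continuous_on_eq_continuous_at[OF open_UNIV]
proof
  fix y :: real
  have "((\<lambda>y::real. y * ln (- y)) \<longlongrightarrow> 0) (at_left 0)"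
    by real_asymp
  then have "((\<lambda>y::real. y * ln y) \<longlongrightarrow> 0) (at_left 0)"
    by (simp add: ln_minus)
  moreover have "((\<lambda>y::real. y * ln y) \<longlongrightarrow> 0) (at_right 0)"
    by real_asymp
  ultimately have "isCont (\<lambda>y::real. y * ln y) 0"
    by (simp add: isCont_def filterlim_at_split)
  then show "isCont (\<lambda>y::real. y * ln y) y"
    by (cases "y = 0") (auto intro!: continuous_intros)
qed

lemma continuous_on_mult_ln [continuous_intros]:
  fixes f :: "'a::topological_space \<Rightarrow> real"
  assumes "continuous_on S f"
  shows "continuous_on S (\<lambda>x. f x * ln (f x))"
  using continuous_on_compose2[OF continuous_mult_ln assms] by simp

text \<open>The logarithm is even here, \<open>ln (- y) = ln y\<close>, so one antiderivative serves on both
  sides of the singularity \<open>d\<close>; as \<open>y * ln y\<close> is continuous at 0, the fundamental theorem may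
  skip that point.\<close>

lemma has_integral_ln_shift:
  fixes a b d :: real
  assumes "a \<le> b"
  shows "((\<lambda>r. ln (r - d)) has_integral
           ((b - d) * ln (b - d) - (b - d) - ((a - d) * ln (a - d) - (a - d)))) {a..b}"
proof (rule fundamental_theorem_of_calculus_interior_strong[where S = "{d}"])
  show "((\<lambda>r. (r - d) * ln (r - d) - (r - d)) has_vector_derivative ln (x - d)) (at x)"
    if "x \<in> {a<..<b} - {d}" for x
    unfolding has_real_derivative_iff_has_vector_derivative[symmetric]
  proof -
    have d: "((\<lambda>r. ln (r - d)) has_real_derivative 1 / (x - d) * 1) (at x)"
      using that by (intro DERIV_chain2[OF has_real_derivative_ln_nonzero]) (auto intro!: derivative_eq_intros)
    have i: "((\<lambda>r. r - d) has_real_derivative 1) (at x)"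
      by (auto intro!: derivative_eq_intros)
    show "((\<lambda>r. (r - d) * ln (r - d) - (r - d)) has_real_derivative ln (x - d)) (at x)"
      using DERIV_diff[OF DERIV_mult[OF i d] i] that by simp
  qed
qed (use assms in \<open>auto intro!: continuous_intros\<close>)

text \<open>The density of \<open>Q\<close> at \<open>x\<close> given \<open>r\<close>, restricted to the event \<open>1 < r + s\<close> on which \<open>Q\<close>
  increases with \<open>t\<close>: the integral of \<open>1 / p\<close> over the admissible values of \<open>p = r + s - 1\<close>,
  which run from \<open>max ((x - w) / r) ((w - x) / (1 - r))\<close> to \<open>r\<close>. It is the logarithm of the
  quotient of these two endpoints, and is meant for \<open>x \<le> r\<close> and \<open>x \<noteq> w\<close>; for smaller \<open>r\<close> no \<open>p\<close> is
  admissible.\<close>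

definition ascending_density :: "real \<Rightarrow> real \<Rightarrow> real" where
  "ascending_density x r =
     (let w = r * (1 - r) in ln (if x < w then w / (w - x) else r\<^sup>2 / (x - w)))"

lemma ascending_density_nonneg:
  assumes "0 < x" "x \<le> r" "r \<le> 1"
  shows "0 \<le> ascending_density x r"
proof -
  have "1 \<le> r\<^sup>2 / (x - r * (1 - r))" if "r * (1 - r) < x"
    using that assms by (simp add: field_simps power2_eq_square)
  moreover have "1 \<le> r * (1 - r) / (r * (1 - r) - x)" if "x < r * (1 - r)"
    using that assms by (simp add: field_simps)
  ultimately show ?thesis
    by (cases "x = r * (1 - r)") (auto simp: ascending_density_def Let_def)
qed

text \<open>For \<open>x < 1 / 4\<close> the polynomial \<open>r\<^sup>2 - r + x\<close> has roots \<open>a\<close> and \<open>b\<close> in the unit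
  interval with \<open>a + b = 1\<close> and \<open>a * b = x\<close>. Splitting the logarithms isolates the singularities
  at the roots and leaves a correction on \<open>{a..b}\<close> that is odd about \<open>1 / 2\<close>.\<close>

lemma ascending_density_factored:
  assumes "0 < a" "a < b" "a + b = 1" "r \<noteq> a" "r \<noteq> b" "0 < r" "r \<le> 1"
  shows "ascending_density (a * b) r =
    2 * ln r - ln (r - a) - ln (r - b) + (if r \<in> {a..b} then ln (1 - r) - ln r else 0)"
proof -
  have b: "b = 1 - a" using assms(3) by simp
  have w: "r * (1 - r) - a * b = (r - a) * (b - r)" "a * b - r * (1 - r) = (r - a) * (r - b)"
    unfolding b by (simp_all add: algebra_simps)
  have *: "a * b < r * (1 - r) \<longleftrightarrow> r \<in> {a<..<b}"
  proof -
    have "a * b < r * (1 - r) \<longleftrightarrow> 0 < (r - a) * (b - r)" unfolding w(1)[symmetric] by simp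
    then show ?thesis using assms by (auto simp: zero_less_mult_iff)
  qed
  have l: "ln (b - r) = ln (r - b)" using ln_minus[of "r - b"] by simp
  show ?thesis
  proof (cases "r \<in> {a<..<b}")
    case True
    then have "r < 1" using assms by auto
    then show ?thesis using True * assms
      by (simp add: ascending_density_def Let_def w ln_div ln_mult l)
  next
    case False
    then show ?thesis using * assms
      by (auto simp add: ascending_density_def Let_def w ln_div ln_mult power2_eq_square)
  qed
qed

text \<open>The odd correction integrates to 0, and the rest is a combination of shifted logarithms. In
  the resulting value \<open>x - a = - (a\<^sup>2)\<close> and \<open>x - b = - (b\<^sup>2)\<close>, so everything collapses to the
  binary entropy of \<open>a\<close>.\<close>

lemma has_integral_ascending_density_small:
  assumes ab: "0 < a" "a < b" "a + b = 1"
  shows "(ascending_density (a * b) has_integral - 3 * (a * ln a + b * ln b)) {a * b..1}"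
proof -
  define x where "x = a * b"
  have x: "0 < x" "x < a" "b < 1"
    using ab unfolding x_def by (auto simp: )
  have b: "b = 1 - a" using ab by simp
  have sq: "x - a = - (a\<^sup>2)" "x - b = - (b\<^sup>2)"
    by (auto simp: x_def b power2_eq_square algebra_simps)
  have "((\<lambda>r. ln (1 - r) - ln r) has_integral
      (- ((1 - b) * ln (1 - b) - (1 - b)) - (b * ln b - b))
      - (- ((1 - a) * ln (1 - a) - (1 - a)) - (a * ln a - a))) {a..b}"
  proof (rule fundamental_theorem_of_calculus_interior_strong[where S = "{}"])
    show "((\<lambda>r. - ((1 - r) * ln (1 - r) - (1 - r)) - (r * ln r - r)) has_vector_derivative
        ln (1 - r) - ln r) (at r)" if "r \<in> {a<..<b} - {}" for r
      unfolding has_real_derivative_iff_has_vector_derivative[symmetric]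
      using that ab by (auto intro!: derivative_eq_intros)
  qed (use ab in \<open>auto intro!: continuous_intros\<close>)
  then have "((\<lambda>r. ln (1 - r) - ln r) has_integral 0) {a..b}"
    by (simp add: b)
  then have mid: "((\<lambda>r. if r \<in> {a..b} then ln (1 - r) - ln r else 0) has_integral 0) {x..1}"
    using x ab by (subst has_integral_restrict) auto
  have 1: "((\<lambda>r. 2 * ln r - ln (r - a) - ln (r - b)
        + (if r \<in> {a..b} then ln (1 - r) - ln r else 0)) has_integral
      2 * (1 * ln 1 - 1 - (x * ln x - x))
      - ((1 - a) * ln (1 - a) - (1 - a) - ((x - a) * ln (x - a) - (x - a)))
      - ((1 - b) * ln (1 - b) - (1 - b) - ((x - b) * ln (x - b) - (x - b))) + 0) {x..1}"
    using has_integral_ln_shift[of x 1 0] has_integral_ln_shift[of x 1 a]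
      has_integral_ln_shift[of x 1 b] x ab mid
    by (intro has_integral_add has_integral_diff has_integral_mult_right) auto
  have lnx: "ln x = ln a + ln b" using ab by (simp add: x_def ln_mult)
  have lna: "ln (x - a) = 2 * ln a" "ln (x - b) = 2 * ln b"
    using ab by (simp_all add: sq ln_minus ln_realpow)
  have val: "2 * (1 * ln 1 - 1 - (x * ln x - x))
      - ((1 - a) * ln (1 - a) - (1 - a) - ((x - a) * ln (x - a) - (x - a)))
      - ((1 - b) * ln (1 - b) - (1 - b) - ((x - b) * ln (x - b) - (x - b))) + 0
     = - 3 * (a * ln a + b * ln b)"
    unfolding lna lnx by (simp add: x_def b) (simp add: algebra_simps power2_eq_square)
  have "(ascending_density x has_integral - 3 * (a * ln a + b * ln b)) {x..1}"
    using 1[unfolded val]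
  proof (rule has_integral_spike_finite[where S = "{a, b}", rotated 2])
    fix r assume "r \<in> {x..1} - {a, b}"
    then have "r \<noteq> a" "r \<noteq> b" "0 < r" "r \<le> 1" using x by auto
    then show "ascending_density x r = 2 * ln r - ln (r - a) - ln (r - b)
        + (if r \<in> {a..b} then ln (1 - r) - ln r else 0)"
      unfolding x_def by (rule ascending_density_factored[OF ab])
  qed simp
  then show ?thesis by (simp add: x_def)
qed

text \<open>With \<open>m = tan t\<close> the first argument is the negated cotangent of \<open>2 * t\<close>, hence
  \<open>tan (2 * t - pi / 2)\<close>, and \<open>1 / m = tan (pi / 2 - t)\<close>. For \<open>0 < t < pi / 2\<close> both angles lie in
  the range of the principal branch.\<close>

lemma arctan_triple:
  fixes m :: real
  assumes "0 < m"
  shows "arctan ((m\<^sup>2 - 1) / (2 * m)) - arctan (1 / m) = 3 * arctan m - pi"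
proof -
  define t where "t = arctan m"
  have t: "0 < t" "t < pi / 2" and m: "m = tan t"
    using assms arctan_ubound by (auto simp: t_def tan_arctan)
  have c: "cos t > 0" "sin t > 0" using t by (auto intro!: cos_gt_zero sin_gt_zero)
  have "tan (2 * t - pi / 2) = (m\<^sup>2 - 1) / (2 * m)"
  proof -
    have "tan (2 * t - pi / 2) = - cos (2 * t) / sin (2 * t)"
      by (simp add: tan_def sin_diff cos_diff)
    also have "\<dots> = (m\<^sup>2 - 1) / (2 * m)"
      unfolding cos_double sin_double using c
      by (simp add: m tan_def field_simps power2_eq_square)
    finally show ?thesis .
  qed
  then have "arctan ((m\<^sup>2 - 1) / (2 * m)) = 2 * t - pi / 2"
    using t by (intro arctan_unique) auto
  moreover have "arctan (1 / m) = pi / 2 - t"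
    using arctan_inverse[of m] assms by (simp add: t_def inverse_eq_divide)
  ultimately show ?thesis by (simp add: t_def)
qed

text \<open>For \<open>1 / 4 < x\<close> the quadratic \<open>r\<^sup>2 - r + x = (r - 1 / 2)\<^sup>2 + (m / 2)\<^sup>2\<close> has no real root, so
  the integrand is smooth and integration by parts produces an arctangent.\<close>

lemma has_integral_ascending_density_large:
  assumes x: "1 / 4 < x" "x \<le> 1"
  defines "m \<equiv> sqrt (4 * x - 1)"
  shows "(ascending_density x has_integral - 3 / 2 * ln x + m * (- pi + 3 * arctan m)) {x..1}"
proof -
  have m: "0 < m" "m\<^sup>2 = 4 * x - 1" using x by (auto simp: m_def)
  \<comment> \<open>antiderivative of \<open>2 * ln r - ln (r\<^sup>2 - r + x)\<close>, in the variable \<open>r - 1 / 2\<close> for the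
    second summand\<close>
  define K where "K r = 2 * (r * ln r - r) - ((r - 1/2) * ln (r\<^sup>2 - r + x) - 2 * (r - 1/2)
      + m * arctan ((2 * r - 1) / m))" for r :: real
  have pos: "0 < r\<^sup>2 - r + x" for r
  proof -
    have "r\<^sup>2 - r + x = (r - 1/2)\<^sup>2 + (x - 1/4)" by (simp add: power2_eq_square field_simps)
    also have "\<dots> > 0" using x by (intro add_nonneg_pos) auto
    finally show ?thesis .
  qed
  have der: "(K has_real_derivative (2 * ln r - ln (r\<^sup>2 - r + x))) (at r)" if "0 < r" for r
  proof -
    have f: "m\<^sup>2 + (2 * r - 1)\<^sup>2 = 4 * (r\<^sup>2 - r + x)"
      unfolding m(2) by (simp add: power2_eq_square algebra_simps)
    have e: "1 + ((2 * r - 1) / m)\<^sup>2 = 4 * (r\<^sup>2 - r + x) / m\<^sup>2"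
      unfolding f[symmetric] using m(1) by (simp add: power_divide add_divide_eq_iff)
    have i: "m * (inverse (4 * E / m\<^sup>2) * (2 / m)) = m\<^sup>2 / (2 * E)" if "E > 0" for E
      using m(1) that by (simp add: field_simps power2_eq_square)
    have *: "m * (inverse (1 + ((2 * r - 1) / m)\<^sup>2) * (2 / m)) = m\<^sup>2 / (2 * (r\<^sup>2 - r + x))"
      unfolding e by (rule i[OF pos])
    have d: "((2 * r - 1) * (r - 1/2)) / (r\<^sup>2 - r + x) + m\<^sup>2 / (2 * (r\<^sup>2 - r + x)) = 2"
    proof -
      have "((2 * r - 1) * (r - 1/2)) / E + m\<^sup>2 / (2 * E) = (m\<^sup>2 + (2 * r - 1)\<^sup>2) / (2 * E)" for E
        by (cases "E = 0") (simp_all add: field_simps power2_eq_square)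
      moreover have "4 * E / (2 * E) = 2" if "E > 0" for E :: real using that by simp
      ultimately show ?thesis unfolding f using pos[of r] by metis
    qed
    have A: "((\<lambda>r. r * ln r - r) has_real_derivative ln r) (at r)"
      using that by (auto intro!: derivative_eq_intros)
    have B: "((\<lambda>r. (r - 1/2) * ln (r\<^sup>2 - r + x)) has_real_derivative
        ln (r\<^sup>2 - r + x) + ((2 * r - 1) * (r - 1/2)) / (r\<^sup>2 - r + x)) (at r)"
      using pos[of r] by (auto intro!: derivative_eq_intros)
    have C: "((\<lambda>r. m * arctan ((2 * r - 1) / m)) has_real_derivative
        m * (inverse (1 + ((2 * r - 1) / m)\<^sup>2) * (2 / m))) (at r)"
      using m(1) by (auto intro!: derivative_eq_intros)
    have D: "((\<lambda>r. 2 * (r - 1/2)) has_real_derivative 2) (at r)"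
      by (auto intro!: derivative_eq_intros)
    have "(K has_real_derivative 2 * ln r
        - (ln (r\<^sup>2 - r + x) + ((2 * r - 1) * (r - 1/2)) / (r\<^sup>2 - r + x) - 2
          + m * (inverse (1 + ((2 * r - 1) / m)\<^sup>2) * (2 / m)))) (at r)"
      unfolding K_def by (intro DERIV_diff DERIV_add DERIV_cmult A B C D)
    then show ?thesis unfolding * by (rule DERIV_cong) (use d in linarith)
  qed
  have int: "((\<lambda>r. 2 * ln r - ln (r\<^sup>2 - r + x)) has_integral K 1 - K x) {x..1}"
  proof (rule fundamental_theorem_of_calculus)
    show "(K has_vector_derivative 2 * ln r - ln (r\<^sup>2 - r + x)) (at r within {x..1})"
      if "r \<in> {x..1}" for r
      unfolding has_real_derivative_iff_has_vector_derivative[symmetric]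
      using that x by (intro DERIV_subset[OF der]) auto
  qed (use x in auto)
  have eq: "ascending_density x r = 2 * ln r - ln (r\<^sup>2 - r + x)" if "r \<in> {x..1}" for r
  proof -
    have "\<not> x < r * (1 - r)" "x - r * (1 - r) = r\<^sup>2 - r + x"
      using pos[of r] by (auto simp: power2_eq_square algebra_simps)
    then show ?thesis
      using that x pos[of r] by (auto simp: ascending_density_def Let_def ln_div ln_realpow)
  qed
  have "K 1 - K x = - 3 / 2 * ln x + m * (- pi + 3 * arctan m)"
  proof -
    have "2 * x - 1 = (m\<^sup>2 - 1) / 2" unfolding m(2) by simp
    then have "(2 * x - 1) / m = (m\<^sup>2 - 1) / (2 * m)"
      by (simp only: divide_divide_eq_left)
    then have a: "arctan ((2 * x - 1) / m) = 3 * arctan m - pi + arctan (1 / m)"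
      using arctan_triple[OF m(1)] by simp
    have l: "ln (x\<^sup>2) = 2 * ln x" using x by (simp add: ln_realpow)
    show ?thesis
      by (simp add: K_def a l) (simp add: algebra_simps)
  qed
  then show ?thesis
    using has_integral_eq[OF eq[symmetric] int] by (simp only:)
qed

section \<open>The continuous density\<close>

text \<open>The continuous version of the density on the closed unit interval. Below \<open>1 / 4\<close> it is six
  times the binary entropy of the smaller root \<open>a\<close> of \<open>r\<^sup>2 - r + c\<close>; because \<open>0 * ln 0 = 0\<close>,
  this form has the right value 0 at \<open>c = 0\<close>, where the logarithm and the inverse hyperbolic
  tangent of the original formula are both singular.\<close>

definition extended_density :: "real \<Rightarrow> real" where
  "extended_density c =
     (if c \<le> 1 / 4
      then let a = (1 - sqrt (1 - 4 * c)) / 2; b = (1 + sqrt (1 - 4 * c)) / 2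
           in - 6 * (a * ln a + b * ln b)
      else - 3 * ln c + 2 * sqrt (4 * c - 1) * (- pi + 3 * arctan (sqrt (4 * c - 1))))"

text \<open>With \<open>q = sqrt (1 - 4 * c)\<close> the roots are \<open>(1 - q) / 2\<close> and \<open>(1 + q) / 2\<close>. The sum of their
  logarithms is \<open>ln c\<close> and the difference is \<open>2 * artanh q\<close>.\<close>

lemma extended_density_eq:
  assumes "0 < c"
  shows "extended_density c = area_ratio_density c"
proof -
  consider "c < 1 / 4" | "c = 1 / 4" | "1 / 4 < c" by linarith
  then show ?thesis
  proof cases
    case 1
    define q where "q = sqrt (1 - 4 * c)"
    have q: "0 < q" "q < 1" "q\<^sup>2 = 1 - 4 * c" using 1 assms by (auto simp: q_def)
    have "c = ((1 - q) / 2) * ((1 + q) / 2)"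
      using q(3) by (simp add: field_simps power2_eq_square)
    also have "ln \<dots> = ln ((1 - q) / 2) + ln ((1 + q) / 2)"
      using q by (intro ln_mult_pos) auto
    finally have lc: "ln c = ln ((1 - q) / 2) + ln ((1 + q) / 2)" .
    have aq: "artanh q = (ln ((1 + q) / 2) - ln ((1 - q) / 2)) / 2"
      using q by (simp add: artanh_def ln_div)
    show ?thesis
      using 1 by (simp add: extended_density_def area_ratio_density_def Let_def flip: q_def)
        (simp add: lc aq field_simps)
  next
    case 2
    have "ln (4::real) = 2 * ln 2" using ln_realpow[of "2::real" 2] by simp
    then show ?thesis
      by (simp add: 2 extended_density_def area_ratio_density_def Let_def ln_div)
  next
    case 3
    then show ?thesis by (simp add: extended_density_def area_ratio_density_def)
  qed
qed

lemma continuous_on_extended_density: "continuous_on {0..1} extended_density"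
proof -
  have 1: "continuous_on {0..1/4} extended_density"
  proof (rule continuous_on_eq)
    show "continuous_on {0..1/4} (\<lambda>c. - 6 *
        ((1 - sqrt (1 - 4 * c)) / 2 * ln ((1 - sqrt (1 - 4 * c)) / 2)
       + (1 + sqrt (1 - 4 * c)) / 2 * ln ((1 + sqrt (1 - 4 * c)) / 2)))"
      by (intro continuous_on_mult_left continuous_on_add continuous_on_mult_ln)
        (auto intro!: continuous_intros)
  qed (simp add: extended_density_def Let_def)
  have 2: "continuous_on {1/4..1} extended_density"
  proof (rule continuous_on_eq)
    show "continuous_on {1/4..1::real} (\<lambda>c. - 3 * ln c
        + 2 * sqrt (4 * c - 1) * (- pi + 3 * arctan (sqrt (4 * c - 1))))"
      by (intro continuous_intros) auto
    show "- 3 * ln c + 2 * sqrt (4 * c - 1) * (- pi + 3 * arctan (sqrt (4 * c - 1)))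
        = extended_density c" if "c \<in> {1/4..1}" for c
    proof (cases "c = 1 / 4")
      case True
      show ?thesis
        using ln_realpow[of "2::real" 2] unfolding True
        by (simp add: extended_density_def Let_def ln_div)
    qed (use that in \<open>simp add: extended_density_def\<close>)
  qed
  have "{0..1} = {0..1/4} \<union> {1/4..1::real}" by auto
  then show ?thesis using continuous_on_closed_Un[OF _ _ 1 2] by simp
qed

lemma has_integral_ascending_density:
  assumes x: "0 < x" "x \<le> 1" "x \<noteq> 1 / 4"
  shows "(ascending_density x has_integral extended_density x / 2) {x..1}"
proof (cases "x < 1 / 4")
  case True
  define q where "q = sqrt (1 - 4 * x)"
  have q: "0 < q" "q < 1" "q\<^sup>2 = 1 - 4 * x" using True x by (auto simp: q_def)
  have "(1 - q) / 2 * ((1 + q) / 2) = x"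
    using q(3) by (simp add: field_simps power2_eq_square)
  then show ?thesis
    using has_integral_ascending_density_small[of "(1 - q) / 2" "(1 + q) / 2"] q True
    by (simp add: extended_density_def Let_def flip: q_def add_divide_distrib)
next
  case False
  then have "extended_density x / 2
      = - 3 / 2 * ln x + sqrt (4 * x - 1) * (- pi + 3 * arctan (sqrt (4 * x - 1)))"
    using x by (simp add: extended_density_def field_simps)
  then show ?thesis
    using has_integral_ascending_density_large[of x] x False by (auto simp only:)
qed

lemma extended_density_nonneg:
  assumes "0 \<le> x" "x \<le> 1"
  shows "0 \<le> extended_density x"
proof (cases "x \<le> 1 / 4")
  case True
  have *: "y * ln y \<le> 0" if "0 \<le> y" "y \<le> 1" for y :: real
    using that by (cases "y = 0") (auto simp: mult_nonneg_nonpos)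
  have q: "0 \<le> sqrt (1 - 4 * x)" "sqrt (1 - 4 * x) \<le> 1" using True assms by auto
  show ?thesis
    using True *[of "(1 - sqrt (1 - 4 * x)) / 2"] *[of "(1 + sqrt (1 - 4 * x)) / 2"] q
    by (simp add: extended_density_def Let_def)
next
  case False
  then have "0 \<le> extended_density x / 2"
    using assms by (intro has_integral_nonneg[OF has_integral_ascending_density]
        ascending_density_nonneg) auto
  then show ?thesis by simp
qed

section \<open>Integration over the unit cube\<close>

text \<open>Given \<open>r\<close> and \<open>s\<close>, the variable \<open>Q\<close> is uniform between its values \<open>(1 - r) * (1 - s)\<close>
  and \<open>r * s\<close> at \<open>t = 0\<close> and \<open>t = 1\<close>. This is its density at \<open>x\<close> where the second value is
  the larger one.\<close>

definition ascending_kernel :: "real \<Rightarrow> real \<Rightarrow> real \<Rightarrow> real" where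
  "ascending_kernel x r s =
     (if 0 \<le> r \<and> r \<le> 1 \<and> 0 \<le> s \<and> s \<le> 1 \<and> 1 < r + s \<and> (1 - r) * (1 - s) \<le> x \<and> x \<le> r * s
      then 1 / (r + s - 1) else 0)"

text \<open>The same density without the restriction. The fraction is the \<open>t\<close> at which \<open>Q = x\<close>; on the
  null set \<open>r + s = 1\<close>, where \<open>Q\<close> does not depend on \<open>t\<close>, division by zero makes the value 0.\<close>

definition conditional_density :: "real \<Rightarrow> real \<Rightarrow> real \<Rightarrow> real" where
  "conditional_density x r s =
     (if 0 \<le> r \<and> r \<le> 1 \<and> 0 \<le> s \<and> s \<le> 1 \<and> (x - (1 - r) * (1 - s)) / (r + s - 1) \<in> {0..1}
      then 1 / \<bar>r + s - 1\<bar> else 0)"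

lemma borel_measurable_ascending_kernel [measurable]:
  assumes [measurable]: "f \<in> borel_measurable N" "g \<in> borel_measurable N" "h \<in> borel_measurable N"
  shows "(\<lambda>\<omega>. ascending_kernel (f \<omega>) (g \<omega>) (h \<omega>)) \<in> borel_measurable N"
  unfolding ascending_kernel_def by measurable

lemma borel_measurable_conditional_density [measurable]:
  assumes [measurable]: "f \<in> borel_measurable N" "g \<in> borel_measurable N" "h \<in> borel_measurable N"
  shows "(\<lambda>\<omega>. conditional_density (f \<omega>) (g \<omega>) (h \<omega>)) \<in> borel_measurable N"
  unfolding conditional_density_def atLeastAtMost_iff by measurable

lemma ascending_kernel_nonneg: "0 \<le> ascending_kernel x r s"
  by (simp add: ascending_kernel_def)

text \<open>The reflection \<open>(r, s) \<mapsto> (1 - r, 1 - s)\<close> swaps the values of \<open>Q\<close> at \<open>t = 0\<close> and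
  \<open>t = 1\<close>, hence exchanges the ascending and the descending case.\<close>

lemma conditional_density_split:
  "conditional_density x r s = ascending_kernel x r s + ascending_kernel x (1 - r) (1 - s)"
proof -
  consider "r + s = 1" | "1 < r + s" | "r + s < 1" by linarith
  then show ?thesis
  proof cases
    case 1
    then show ?thesis by (simp add: conditional_density_def ascending_kernel_def)
  next
    case 2
    then have "(x - (1 - r) * (1 - s)) / (r + s - 1) \<in> {0..1} \<longleftrightarrow> (1 - r) * (1 - s) \<le> x \<and> x \<le> r * s"
      by (simp add: zero_le_divide_iff divide_le_eq_1) (auto simp: algebra_simps)
    then show ?thesis using 2 by (simp add: conditional_density_def ascending_kernel_def)
  next
    case 3
    then have "(x - (1 - r) * (1 - s)) / (r + s - 1) \<in> {0..1} \<longleftrightarrow> x \<le> (1 - r) * (1 - s) \<and> r * s \<le> x"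
      by (simp add: zero_le_divide_iff divide_le_eq_1) (auto simp: algebra_simps)
    then show ?thesis using 3
      by (auto simp add: conditional_density_def ascending_kernel_def abs_if)
  qed
qed

text \<open>Both constraints on \<open>x\<close> are lower bounds on \<open>s\<close>, so \<open>s\<close> ranges over an interval ending at 1;
  it starts at \<open>1 - r + l\<close> with \<open>l > 0\<close> exactly because \<open>x \<noteq> r * (1 - r)\<close>. If
  \<open>x = r * (1 - r)\<close>, the integral diverges.\<close>

lemma nn_integral_ascending_kernel_slice:
  assumes x: "0 < x" and r: "0 < r" "r < 1" and ne: "r * (1 - r) \<noteq> x"
  shows "(\<integral>\<^sup>+ s. ascending_kernel x r s \<partial>lborel) = ennreal (indicator {x..1} r * ascending_density x r)"
proof (cases "x \<le> r")
  case False
  have "ascending_kernel x r s = 0" for s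
  proof -
    have "\<not> x \<le> r * s" if "s \<le> 1"
      using mult_left_le[of s r] r that False by linarith
    then show ?thesis by (auto simp: ascending_kernel_def)
  qed
  then show ?thesis using False by simp
next
  case True
  define l where "l = max ((x - r * (1 - r)) / r) ((r * (1 - r) - x) / (1 - r))"
  have l: "0 < l" "l \<le> r"
    using r ne True x by (auto simp: l_def less_max_iff_disj divide_simps algebra_simps)
  have eq: "ascending_kernel x r s = 1 / (r + s - 1) * indicator {1 - r + l..1} s" for s
  proof -
    have "(1 - r) * (1 - s) \<le> x \<longleftrightarrow> (r * (1 - r) - x) / (1 - r) \<le> r + s - 1"
      using r by (simp add: divide_le_eq) (auto simp: algebra_simps)
    moreover have "x \<le> r * s \<longleftrightarrow> (x - r * (1 - r)) / r \<le> r + s - 1"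
      using r by (simp add: divide_le_eq) (auto simp: algebra_simps)
    ultimately have "(1 - r) * (1 - s) \<le> x \<and> x \<le> r * s \<longleftrightarrow> 1 - r + l \<le> s"
      by (auto simp: l_def)
    then show ?thesis using l r by (auto simp: ascending_kernel_def indicator_def)
  qed
  have "(\<integral>\<^sup>+ s. ascending_kernel x r s \<partial>lborel)
      = (\<integral>\<^sup>+ s. ennreal (1 / (r + s - 1)) * indicator {1 - r + l..1} s \<partial>lborel)"
    unfolding eq by (intro nn_integral_cong) (auto simp: indicator_def)
  also have "\<dots> = ennreal (ln (r + 1 - 1) - ln (r + (1 - r + l) - 1))"
  proof (rule nn_integral_FTC_Icc)
    fix s assume s: "s \<in> {1 - r + l..1}"
    then show "((\<lambda>s. ln (r + s - 1)) has_real_derivative 1 / (r + s - 1)) (at s)"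
      using l by (auto intro!: derivative_eq_intros)
    show "0 \<le> 1 / (r + s - 1)" using s l by simp
  qed (use l in auto)
  also have "ln (r + 1 - 1) - ln (r + (1 - r + l) - 1) = ln (r / l)"
    using l r by (simp add: ln_div)
  also have "r / l = (if x < r * (1 - r) then r * (1 - r) / (r * (1 - r) - x)
      else r\<^sup>2 / (x - r * (1 - r)))"
  proof (cases "x < r * (1 - r)")
    case True
    then have "(x - r * (1 - r)) / r < 0" "0 < (r * (1 - r) - x) / (1 - r)"
      using r by (auto simp: divide_less_0_iff)
    then have "l = (r * (1 - r) - x) / (1 - r)" by (simp add: l_def)
    then show ?thesis using True by simp
  next
    case False
    then have "(r * (1 - r) - x) / (1 - r) < 0" "0 < (x - r * (1 - r)) / r"
      using r ne by (auto simp: divide_less_0_iff)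
    then have "l = (x - r * (1 - r)) / r" by (simp add: l_def)
    then show ?thesis using False by (simp add: power2_eq_square)
  qed
  finally show ?thesis using True r by (simp add: ascending_density_def Let_def)
qed

lemma AE_ascending_slice: "AE r in lborel. r \<noteq> 0 \<and> r \<noteq> 1 \<and> r * (1 - r) \<noteq> (x::real)"
proof -
  have "finite {r::real. r * (1 - r) = x}"
  proof (cases "\<exists>r0. r0 * (1 - r0) = x")
    case True
    then obtain r0 where r0: "r0 * (1 - r0) = x" by blast
    have "r = r0 \<or> r = 1 - r0" if "r * (1 - r) = x" for r
    proof -
      have "(r - r0) * (r - (1 - r0)) = 0" using that r0 by (simp add: algebra_simps)
      then show ?thesis by auto
    qed
    then have "{r. r * (1 - r) = x} \<subseteq> {r0, 1 - r0}" by auto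
    then show ?thesis by (rule finite_subset) simp
  qed simp
  then have "finite ({0, 1} \<union> {r::real. r * (1 - r) = x})" by simp
  then have "{0, 1} \<union> {r::real. r * (1 - r) = x} \<in> null_sets lborel"
    by (intro finite_imp_null_set_lborel)
  then show ?thesis by (rule AE_I') auto
qed

lemma nn_integral_ascending_kernel:
  assumes x: "0 < x" "x \<le> 1" "x \<noteq> 1 / 4"
  shows "(\<integral>\<^sup>+ r. \<integral>\<^sup>+ s. ascending_kernel x r s \<partial>lborel \<partial>lborel) = ennreal (extended_density x / 2)"
proof -
  have "(\<integral>\<^sup>+ r. \<integral>\<^sup>+ s. ascending_kernel x r s \<partial>lborel \<partial>lborel)
      = (\<integral>\<^sup>+ r. ennreal (indicator {x..1} r * ascending_density x r) \<partial>lborel)"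
  proof (intro nn_integral_cong_AE, use AE_ascending_slice[of x] in eventually_elim)
    fix r assume ne: "r \<noteq> 0 \<and> r \<noteq> 1 \<and> r * (1 - r) \<noteq> x"
    show "(\<integral>\<^sup>+ s. ascending_kernel x r s \<partial>lborel) = ennreal (indicator {x..1} r * ascending_density x r)"
    proof (cases "0 < r \<and> r < 1")
      case True
      then show ?thesis using nn_integral_ascending_kernel_slice x ne by blast
    next
      case False
      then have "ascending_kernel x r s = 0" for s using ne by (auto simp: ascending_kernel_def)
      moreover have "r \<notin> {x..1}" using False ne x by auto
      ultimately show ?thesis by simp
    qed
  qed
  also have "\<dots> = ennreal (extended_density x / 2)"
    using x by (intro nn_integral_has_integral_lebesgue has_integral_ascending_density)
      (auto intro!: ascending_density_nonneg)
  finally show ?thesis .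
qed

lemma nn_integral_reflect:
  fixes f :: "real \<Rightarrow> ennreal"
  assumes "f \<in> borel_measurable borel"
  shows "(\<integral>\<^sup>+ x. f (1 - x) \<partial>lborel) = (\<integral>\<^sup>+ x. f x \<partial>lborel)"
  using nn_integral_real_affine[OF assms, of "-1" 1] by simp

lemma nn_integral_conditional_density:
  assumes x: "0 < x" "x \<le> 1" "x \<noteq> 1 / 4"
  shows "(\<integral>\<^sup>+ r. \<integral>\<^sup>+ s. conditional_density x r s \<partial>lborel \<partial>lborel) = ennreal (extended_density x)"
proof -
  have "(\<integral>\<^sup>+ r. \<integral>\<^sup>+ s. conditional_density x r s \<partial>lborel \<partial>lborel)
     = (\<integral>\<^sup>+ r. (\<integral>\<^sup>+ s. ascending_kernel x r s \<partial>lborel)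
            + (\<integral>\<^sup>+ s. ascending_kernel x (1 - r) (1 - s) \<partial>lborel) \<partial>lborel)"
    by (simp add: conditional_density_split ascending_kernel_nonneg ennreal_plus nn_integral_add
        del: ennreal_plus[symmetric])
  also have "\<dots> = (\<integral>\<^sup>+ r. \<integral>\<^sup>+ s. ascending_kernel x r s \<partial>lborel \<partial>lborel)
      + (\<integral>\<^sup>+ r. \<integral>\<^sup>+ s. ascending_kernel x (1 - r) (1 - s) \<partial>lborel \<partial>lborel)"
    by (intro nn_integral_add) measurable
  also have "(\<integral>\<^sup>+ r. \<integral>\<^sup>+ s. ascending_kernel x (1 - r) (1 - s) \<partial>lborel \<partial>lborel)
      = (\<integral>\<^sup>+ r. \<integral>\<^sup>+ s. ascending_kernel x (1 - r) s \<partial>lborel \<partial>lborel)"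
    by (intro nn_integral_cong nn_integral_reflect) measurable
  also have "\<dots> = (\<integral>\<^sup>+ r. \<integral>\<^sup>+ s. ascending_kernel x r s \<partial>lborel \<partial>lborel)"
    by (rule nn_integral_reflect[of "\<lambda>r. \<integral>\<^sup>+ s. ascending_kernel x r s \<partial>lborel"]) measurable
  finally show ?thesis
    using extended_density_nonneg[of x] x
    by (simp add: nn_integral_ascending_kernel flip: ennreal_plus)
qed

text \<open>The substitution \<open>x = (1 - r) * (1 - s) + p * t\<close> with \<open>p = r + s - 1\<close>.\<close>

lemma nn_integral_conditional_density_atMost:
  fixes c r s :: real
  assumes rs: "r \<in> {0..1}" "s \<in> {0..1}" "r + s \<noteq> 1"
  shows "(\<integral>\<^sup>+ t. indicator {0..1} t * indicator {..c} (r * s * t + (1 - r) * (1 - s) * (1 - t)) \<partial>lborel)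
    = (\<integral>\<^sup>+ x. indicator {..c} x * ennreal (conditional_density x r s) \<partial>lborel)"
proof -
  define p where "p = r + s - 1"
  have p: "p \<noteq> 0" using rs by (simp add: p_def)
  have "(\<integral>\<^sup>+ x. indicator {..c} x * ennreal (conditional_density x r s) \<partial>lborel)
    = \<bar>p\<bar> * (\<integral>\<^sup>+ t. indicator {..c} ((1 - r) * (1 - s) + p * t)
        * ennreal (conditional_density ((1 - r) * (1 - s) + p * t) r s) \<partial>lborel)"
    using p by (intro nn_integral_real_affine) measurable
  also have "\<dots> = (\<integral>\<^sup>+ t. \<bar>p\<bar> * (indicator {..c} ((1 - r) * (1 - s) + p * t)
        * ennreal (conditional_density ((1 - r) * (1 - s) + p * t) r s)) \<partial>lborel)"
    by (intro nn_integral_cmult[symmetric]) measurable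
  also have "\<dots> = (\<integral>\<^sup>+ t. indicator {0..1} t
      * indicator {..c} (r * s * t + (1 - r) * (1 - s) * (1 - t)) \<partial>lborel)"
  proof (intro nn_integral_cong)
    fix t :: real
    have "(1 - r) * (1 - s) + p * t = r * s * t + (1 - r) * (1 - s) * (1 - t)"
      by (simp add: p_def algebra_simps)
    moreover have "conditional_density ((1 - r) * (1 - s) + p * t) r s = indicator {0..1} t / \<bar>p\<bar>"
      using rs p by (auto simp: conditional_density_def p_def[symmetric] indicator_def)
    ultimately show "\<bar>p\<bar> * (indicator {..c} ((1 - r) * (1 - s) + p * t)
        * ennreal (conditional_density ((1 - r) * (1 - s) + p * t) r s))
      = indicator {0..1} t * indicator {..c} (r * s * t + (1 - r) * (1 - s) * (1 - t))"
      using p by (auto simp: indicator_def simp flip: ennreal_mult)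
  qed
  finally show ?thesis ..
qed

text \<open>The innermost variable \<open>t\<close> is traded for the value \<open>x\<close> of \<open>Q\<close>; then Tonelli moves \<open>x\<close> to
  the outside and the density at almost every \<open>x\<close> appears.\<close>

lemma nn_integral_cube:
  fixes c :: real
  assumes c: "0 \<le> c" "c \<le> 1"
  shows "(\<integral>\<^sup>+ r. \<integral>\<^sup>+ s. \<integral>\<^sup>+ t. indicator {0..1} r * (indicator {0..1} s * (indicator {0..1} t
      * indicator {..c} (r * s * t + (1 - r) * (1 - s) * (1 - t)))) \<partial>lborel \<partial>lborel \<partial>lborel)
    = ennreal (integral {0..c} extended_density)"
proof -
  let ?K = "\<lambda>x r s. indicator {..c} x * ennreal (conditional_density x r s)"
  have "(\<integral>\<^sup>+ r. \<integral>\<^sup>+ s. \<integral>\<^sup>+ t. indicator {0..1} r * (indicator {0..1} s * (indicator {0..1} t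
      * indicator {..c} (r * s * t + (1 - r) * (1 - s) * (1 - t)))) \<partial>lborel \<partial>lborel \<partial>lborel)
    = (\<integral>\<^sup>+ r. \<integral>\<^sup>+ s. \<integral>\<^sup>+ x. ?K x r s \<partial>lborel \<partial>lborel \<partial>lborel)"
  proof (rule nn_integral_cong, rule nn_integral_cong_AE)
    fix r :: real
    show "AE s in lborel. (\<integral>\<^sup>+ t. indicator {0..1} r * (indicator {0..1} s * (indicator {0..1} t
        * indicator {..c} (r * s * t + (1 - r) * (1 - s) * (1 - t)))) \<partial>lborel)
      = (\<integral>\<^sup>+ x. ?K x r s \<partial>lborel)"
      using AE_lborel_singleton[of "1 - r"]
    proof eventually_elim
      fix s assume "s \<noteq> 1 - r"
      then show "(\<integral>\<^sup>+ t. indicator {0..1} r * (indicator {0..1} s * (indicator {0..1} t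
        * indicator {..c} (r * s * t + (1 - r) * (1 - s) * (1 - t)))) \<partial>lborel)
      = (\<integral>\<^sup>+ x. ?K x r s \<partial>lborel)"
      proof (cases "r \<in> {0..1} \<and> s \<in> {0..1}")
        case True
        then show ?thesis using nn_integral_conditional_density_atMost[of r s c] \<open>s \<noteq> 1 - r\<close> by simp
      next
        case False
        then have "indicator {0..1} r = (0 :: ennreal) \<or> indicator {0..1} s = (0 :: ennreal)"
          by (auto simp: indicator_def)
        moreover have "conditional_density x r s = 0" for x
          using False by (auto simp: conditional_density_def)
        ultimately show ?thesis by auto
      qed
    qed
  qed
  also have "\<dots> = (\<integral>\<^sup>+ r. \<integral>\<^sup>+ x. \<integral>\<^sup>+ s. ?K x r s \<partial>lborel \<partial>lborel \<partial>lborel)"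
    by (intro nn_integral_cong lborel_pair.Fubini') measurable
  also have "\<dots> = (\<integral>\<^sup>+ x. \<integral>\<^sup>+ r. \<integral>\<^sup>+ s. ?K x r s \<partial>lborel \<partial>lborel \<partial>lborel)"
    by (intro lborel_pair.Fubini') measurable
  also have "\<dots> = (\<integral>\<^sup>+ x. ennreal (indicator {0..c} x * extended_density x) \<partial>lborel)"
  proof (intro nn_integral_cong_AE)
    have "AE x in lborel. x \<noteq> 0 \<and> x \<noteq> (1 / 4 :: real)"
      using AE_lborel_singleton[of "0::real"] AE_lborel_singleton[of "1/4::real"] by eventually_elim simp
    then show "AE x in lborel. (\<integral>\<^sup>+ r. \<integral>\<^sup>+ s. ?K x r s \<partial>lborel \<partial>lborel)
        = ennreal (indicator {0..c} x * extended_density x)"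
    proof eventually_elim
      fix x :: real assume ne: "x \<noteq> 0 \<and> x \<noteq> 1 / 4"
      have "(\<integral>\<^sup>+ r. \<integral>\<^sup>+ s. ?K x r s \<partial>lborel \<partial>lborel)
        = indicator {..c} x * (\<integral>\<^sup>+ r. \<integral>\<^sup>+ s. conditional_density x r s \<partial>lborel \<partial>lborel)"
        by (simp add: nn_integral_cmult)
      also have "\<dots> = ennreal (indicator {0..c} x * extended_density x)"
      proof -
        consider "x < 0" | "c < x" | "0 < x" "x \<le> c" using ne by linarith
        then show ?thesis
        proof cases
          case 1
          have "ascending_kernel x r s = 0" for r s
          proof -
            have "\<not> (1 - r) * (1 - s) \<le> x" if "r \<le> 1" "s \<le> 1"
            proof -
              have "0 \<le> (1 - r) * (1 - s)" using that by simp
              then show ?thesis using 1 by linarith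
            qed
            then show ?thesis by (auto simp: ascending_kernel_def)
          qed
          then show ?thesis using 1 by (simp add: conditional_density_split)
        next
          case 3
          then show ?thesis using ne c by (simp add: nn_integral_conditional_density)
        qed simp
      qed
      finally show "(\<integral>\<^sup>+ r. \<integral>\<^sup>+ s. ?K x r s \<partial>lborel \<partial>lborel)
        = ennreal (indicator {0..c} x * extended_density x)" .
    qed
  qed
  also have "\<dots> = ennreal (integral {0..c} extended_density)"
  proof (rule nn_integral_has_integral_lebesgue)
    show "0 \<le> extended_density x" if "x \<in> {0..c}" for x
      using extended_density_nonneg that c by simp
    have "continuous_on {0..c} extended_density"
      by (rule continuous_on_subset[OF continuous_on_extended_density]) (use c in auto)
    then show "(extended_density has_integral integral {0..c} extended_density) {0..c}"
      using integrable_continuous_real by blast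
  qed
  finally show ?thesis .
qed

section \<open>Signed areas\<close>

lemma signed_area_ratio:
  fixes A B C :: "real ^ 2"
  assumes "signed_area A B C \<noteq> 0"
  shows "signed_area (B + r *\<^sub>R (C - B)) (C + s *\<^sub>R (A - C)) (A + t *\<^sub>R (B - A)) / signed_area A B C
    = r * s * t + (1 - r) * (1 - s) * (1 - t)"
  using assms unfolding divide_eq_eq signed_area_def by simp (simp add: algebra_simps)

lemma signed_area_eq_0_imp_collinear:
  assumes "signed_area A B C = 0"
  shows "collinear {A, B, C}"
proof -
  have z: "(B $ 1 - A $ 1) * (C $ 2 - A $ 2) = (C $ 1 - A $ 1) * (B $ 2 - A $ 2)"
    using assms by (simp add: signed_area_def)
  show ?thesis
  proof (cases "A = B")
    case False
    then consider "B $ 1 \<noteq> A $ 1" | "B $ 2 \<noteq> A $ 2" by (auto simp: vec_eq_iff forall_2)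
    then have "\<exists>k. C - A = k *\<^sub>R (B - A)"
    proof cases
      case 1
      then have "(C $ 1 - A $ 1) / (B $ 1 - A $ 1) * (B $ 2 - A $ 2) = C $ 2 - A $ 2"
        using z by (simp add: divide_eq_eq mult.commute)
      then show ?thesis using 1
        by (intro exI[of _ "(C $ 1 - A $ 1) / (B $ 1 - A $ 1)"]) (simp add: vec_eq_iff forall_2)
    next
      case 2
      then have "(C $ 2 - A $ 2) / (B $ 2 - A $ 2) * (B $ 1 - A $ 1) = C $ 1 - A $ 1"
        using z by (simp add: divide_eq_eq mult.commute)
      then show ?thesis using 2
        by (intro exI[of _ "(C $ 2 - A $ 2) / (B $ 2 - A $ 2)"]) (simp add: vec_eq_iff forall_2)
    qed
    then obtain k where k: "C = A + k *\<^sub>R (B - A)" by (auto simp: algebra_simps)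
    have "\<exists>u v. \<forall>x\<in>{A, B, C}. \<exists>c. x = u + c *\<^sub>R v"
    proof (rule exI[of _ A], rule exI[of _ "B - A"], rule ballI)
      fix x assume "x \<in> {A, B, C}"
      then consider "x = A" | "x = B" | "x = C" by auto
      then show "\<exists>c. x = A + c *\<^sub>R (B - A)"
        by cases (use k in \<open>auto intro: exI[of _ 0] exI[of _ 1]\<close>)
    qed
    then show ?thesis by (simp only: collinear_alt)
  qed simp
qed

section \<open>The distribution of the area ratio\<close>

text \<open>The predicate \<open>indep_var\<close> relates two variables with values in one type, so the
  independence of \<open>r\<close> from the pair \<open>(s, t)\<close> is first stated for restrictions of the index
  function and then pushed forward along the projections, as an identity of product measures.\<close>

lemma (in prob_space) distributed_indep_triple:
  fixes r s t :: "'a \<Rightarrow> real" and f :: "real \<Rightarrow> ennreal"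
  assumes indep: "indep_vars (\<lambda>_. borel) (\<lambda>i. [r, s, t] ! i) {..<3::nat}"
    and r: "distributed M lborel r f" and s: "distributed M lborel s f" and t: "distributed M lborel t f"
  shows "distributed M (lborel \<Otimes>\<^sub>M (lborel \<Otimes>\<^sub>M lborel)) (\<lambda>\<omega>. (r \<omega>, s \<omega>, t \<omega>))
           (\<lambda>(x, y, z). f x * (f y * f z))"
proof -
  have "indep_var (PiM {1} (\<lambda>_. borel)) (\<lambda>\<omega>. restrict (\<lambda>i. ([r, s, t] ! i) \<omega>) {1})
      (PiM {2} (\<lambda>_. borel)) (\<lambda>\<omega>. restrict (\<lambda>i. ([r, s, t] ! i) \<omega>) {2::nat})"
    by (rule indep_var_restrict[OF indep]) auto
  from indep_var_compose[OF this, of "\<lambda>g. g 1" borel "\<lambda>g. g 2" borel]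
  have "indep_var borel s borel t"
    by (simp add: comp_def measurable_component_singleton numeral_2_eq_2)
  then have st: "distributed M (lborel \<Otimes>\<^sub>M lborel) (\<lambda>\<omega>. (s \<omega>, t \<omega>)) (\<lambda>(y, z). f y * f z)"
    using s t by (intro distributed_joint_indep lborel.sigma_finite_measure_axioms)
      (simp_all add: indep_var_eq cong: measurable_cong_sets)
  let ?B = "\<lambda>_::nat. borel :: real measure"
  let ?X = "\<lambda>\<omega>. restrict (\<lambda>i. ([r, s, t] ! i) \<omega>) {0::nat}"
  let ?Y = "\<lambda>\<omega>. restrict (\<lambda>i. ([r, s, t] ! i) \<omega>) {1, 2::nat}"
  let ?f = "\<lambda>g::nat \<Rightarrow> real. g 0" and ?g = "\<lambda>g::nat \<Rightarrow> real. (g 1, g 2)"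
  have XY: "indep_var (PiM {0} ?B) ?X (PiM {1, 2} ?B) ?Y"
    by (rule indep_var_restrict[OF indep]) auto
  note [measurable] = indep_var_rv1[OF XY] indep_var_rv2[OF XY]
  have [measurable]: "?f \<in> measurable (PiM {0} ?B) borel"
    "?g \<in> measurable (PiM {1, 2} ?B) (borel \<Otimes>\<^sub>M borel)"
    by (auto intro!: measurable_Pair measurable_component_singleton)
  have fX: "(\<lambda>\<omega>. ?f (?X \<omega>)) = r" and gY: "(\<lambda>\<omega>. ?g (?Y \<omega>)) = (\<lambda>\<omega>. (s \<omega>, t \<omega>))"
    by (simp_all add: numeral_2_eq_2)
  have "distr M borel (\<lambda>\<omega>. ?f (?X \<omega>)) \<Otimes>\<^sub>M distr M (borel \<Otimes>\<^sub>M borel) (\<lambda>\<omega>. ?g (?Y \<omega>))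
      = distr (distr M (PiM {0} ?B) ?X) borel ?f
        \<Otimes>\<^sub>M distr (distr M (PiM {1, 2} ?B) ?Y) (borel \<Otimes>\<^sub>M borel) ?g"
    by (subst (1 2) distr_distr) (simp_all only: comp_def, measurable)
  also have "\<dots> = distr (distr M (PiM {0} ?B) ?X \<Otimes>\<^sub>M distr M (PiM {1, 2} ?B) ?Y)
      (borel \<Otimes>\<^sub>M (borel \<Otimes>\<^sub>M borel)) (\<lambda>(x, y). (?f x, ?g y))"
    by (intro pair_measure_distr prob_space_imp_sigma_finite prob_space.prob_space_distr
        prob_space_distr) measurable
  also have "\<dots> = distr (distr M (PiM {0} ?B \<Otimes>\<^sub>M PiM {1, 2} ?B) (\<lambda>\<omega>. (?X \<omega>, ?Y \<omega>)))
      (borel \<Otimes>\<^sub>M (borel \<Otimes>\<^sub>M borel)) (\<lambda>(x, y). (?f x, ?g y))"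
    using XY by (simp add: indep_var_distribution_eq)
  also have "\<dots> = distr M (borel \<Otimes>\<^sub>M (borel \<Otimes>\<^sub>M borel)) (\<lambda>\<omega>. (?f (?X \<omega>), ?g (?Y \<omega>)))"
    by (subst distr_distr) (simp_all only: comp_def case_prod_conv, measurable)
  finally have "distr M borel r \<Otimes>\<^sub>M distr M (borel \<Otimes>\<^sub>M borel) (\<lambda>\<omega>. (s \<omega>, t \<omega>))
      = distr M (borel \<Otimes>\<^sub>M (borel \<Otimes>\<^sub>M borel)) (\<lambda>\<omega>. (r \<omega>, s \<omega>, t \<omega>))"
    unfolding fX gY by simp
  then have "distr M lborel r \<Otimes>\<^sub>M distr M (lborel \<Otimes>\<^sub>M lborel) (\<lambda>\<omega>. (s \<omega>, t \<omega>))
      = distr M (lborel \<Otimes>\<^sub>M (lborel \<Otimes>\<^sub>M lborel)) (\<lambda>\<omega>. (r \<omega>, s \<omega>, t \<omega>))"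
    by (simp cong: distr_cong sets_pair_measure_cong)
  then have "distributed M (lborel \<Otimes>\<^sub>M (lborel \<Otimes>\<^sub>M lborel)) (\<lambda>\<omega>. (r \<omega>, s \<omega>, t \<omega>))
           (\<lambda>(x, yz). f x * (case yz of (y, z) \<Rightarrow> f y * f z))"
    by (intro distributed_joint_indep' lborel.sigma_finite_measure_axioms r st)
      (simp_all add: lborel_prod lborel.sigma_finite_measure_axioms)
  then show ?thesis by (simp add: case_prod_beta')
qed

lemma nn_integral_lborel_triple:
  fixes f :: "real \<times> real \<times> real \<Rightarrow> ennreal"
  assumes f: "f \<in> borel_measurable (lborel \<Otimes>\<^sub>M (lborel \<Otimes>\<^sub>M lborel))"
  shows "integral\<^sup>N (lborel \<Otimes>\<^sub>M (lborel \<Otimes>\<^sub>M lborel)) f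
    = (\<integral>\<^sup>+ x. \<integral>\<^sup>+ y. \<integral>\<^sup>+ z. f (x, y, z) \<partial>lborel \<partial>lborel \<partial>lborel)"
proof -
  have N: "sigma_finite_measure (lborel \<Otimes>\<^sub>M lborel :: (real \<times> real) measure)"
    by (simp add: lborel_prod lborel.sigma_finite_measure_axioms)
  have "integral\<^sup>N (lborel \<Otimes>\<^sub>M (lborel \<Otimes>\<^sub>M lborel)) f
    = (\<integral>\<^sup>+ x. \<integral>\<^sup>+ w. f (x, w) \<partial>(lborel \<Otimes>\<^sub>M lborel) \<partial>lborel)"
    by (rule sigma_finite_measure.nn_integral_fst[OF N f, symmetric])
  also have "\<dots> = (\<integral>\<^sup>+ x. \<integral>\<^sup>+ y. \<integral>\<^sup>+ z. f (x, y, z) \<partial>lborel \<partial>lborel \<partial>lborel)"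
    by (intro nn_integral_cong lborel.nn_integral_fst[symmetric] measurable_compose[OF _ f]) measurable
  finally show ?thesis .
qed

theorem mainTheorem4:
  fixes M :: "'a measure"
    and A B C :: "real ^ 2"
    and r s t :: "'a \<Rightarrow> real"
    and R S T :: "'a \<Rightarrow> real ^ 2"
    and Q :: "'a \<Rightarrow> real"
  assumes triangle: "\<not> collinear {A, B, C}"
    and prob: "prob_space M"
    and indep: "prob_space.indep_vars M (\<lambda>_. borel) (\<lambda>i. [r, s, t] ! i) {..<3::nat}"
    and unif_r: "distributed M lborel r (\<lambda>x. indicator {0..1} x / measure lborel {0..1::real})"
    and unif_s: "distributed M lborel s (\<lambda>x. indicator {0..1} x / measure lborel {0..1::real})"
    and unif_t: "distributed M lborel t (\<lambda>x. indicator {0..1} x / measure lborel {0..1::real})"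
  defines "R \<equiv> \<lambda>\<omega>. B + r \<omega> *\<^sub>R (C - B)"
    and "S \<equiv> \<lambda>\<omega>. C + s \<omega> *\<^sub>R (A - C)"
    and "T \<equiv> \<lambda>\<omega>. A + t \<omega> *\<^sub>R (B - A)"
    and "Q \<equiv> \<lambda>\<omega>. signed_area (R \<omega>) (S \<omega>) (T \<omega>) / signed_area A B C"
  shows "(\<forall>c\<in>{0<..1}. ((\<lambda>x. measure M {\<omega> \<in> space M. Q \<omega> \<le> x})
            has_real_derivative area_ratio_density c) (at c within {0..1})) \<and>
         (\<exists>L. (area_ratio_density \<longlongrightarrow> L) (at_right 0) \<and>
            ((\<lambda>x. measure M {\<omega> \<in> space M. Q \<omega> \<le> x})
               has_real_derivative L) (at 0 within {0..1}))"
proof -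
  interpret prob_space M by fact
  have nondeg: "signed_area A B C \<noteq> 0"
    using triangle signed_area_eq_0_imp_collinear by blast
  have Q: "Q = (\<lambda>\<omega>. r \<omega> * s \<omega> * t \<omega> + (1 - r \<omega>) * (1 - s \<omega>) * (1 - t \<omega>))"
    unfolding Q_def R_def S_def T_def using signed_area_ratio[OF nondeg] by blast
  have dens: "(\<lambda>x. ennreal (indicator {0..1} x / measure lborel {0..1::real})) = indicator {0..1}"
    by (auto simp: fun_eq_iff indicator_def)
  have joint: "distributed M (lborel \<Otimes>\<^sub>M (lborel \<Otimes>\<^sub>M lborel)) (\<lambda>\<omega>. (r \<omega>, s \<omega>, t \<omega>))
      (\<lambda>(x, y, z). indicator {0..1} x * (indicator {0..1} y * indicator {0..1} z))"
    using unif_r unif_s unif_t unfolding dens by (intro distributed_indep_triple indep)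
  have cdf: "measure M {\<omega> \<in> space M. Q \<omega> \<le> c} = integral {0..c} extended_density"
    if c: "c \<in> {0..1}" for c
  proof -
    let ?N = "lborel \<Otimes>\<^sub>M (lborel \<Otimes>\<^sub>M lborel) :: (real \<times> real \<times> real) measure"
    let ?E = "{(x, y, z). x * y * z + (1 - x) * (1 - y) * (1 - z) \<le> c} :: (real \<times> real \<times> real) set"
    have "closed ?E"
      unfolding case_prod_beta' by (intro closed_Collect_le continuous_intros)
    then have "?E \<in> sets borel" by (rule borel_closed)
    then have E [measurable]: "?E \<in> sets ?N" by (simp only: lborel_prod sets_lborel)
    have "emeasure M {\<omega> \<in> space M. Q \<omega> \<le> c}
        = emeasure M ((\<lambda>\<omega>. (r \<omega>, s \<omega>, t \<omega>)) -` ?E \<inter> space M)"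
      unfolding Q by (intro arg_cong[where f = "emeasure M"]) auto
    also have "\<dots> = (\<integral>\<^sup>+ w. (case w of (x, y, z) \<Rightarrow> indicator {0..1} x * (indicator {0..1} y
        * indicator {0..1} z)) * indicator ?E w \<partial>?N)"
      by (rule distributed_emeasure[OF joint E])
    also have "\<dots> = (\<integral>\<^sup>+ x. \<integral>\<^sup>+ y. \<integral>\<^sup>+ z. indicator {0..1} x * (indicator {0..1} y
        * (indicator {0..1} z
        * indicator {..c} (x * y * z + (1 - x) * (1 - y) * (1 - z)))) \<partial>lborel \<partial>lborel \<partial>lborel)"
      by (subst nn_integral_lborel_triple, measurable)
        (auto intro!: nn_integral_cong simp: indicator_def)
    also have "\<dots> = ennreal (integral {0..c} extended_density)"
      using c by (intro nn_integral_cube) auto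
    finally have "emeasure M {\<omega> \<in> space M. Q \<omega> \<le> c} = ennreal (integral {0..c} extended_density)" .
    moreover have "0 \<le> integral {0..c} extended_density"
      using c by (intro integral_nonneg integrable_continuous_real
          continuous_on_subset[OF continuous_on_extended_density] extended_density_nonneg) auto
    ultimately show ?thesis by (simp add: measure_def)
  qed
  have deriv: "((\<lambda>x. measure M {\<omega> \<in> space M. Q \<omega> \<le> x}) has_real_derivative extended_density c)
      (at c within {0..1})" if "c \<in> {0..1}" for c
    by (rule has_field_derivative_transform_within[OF
          integral_has_real_derivative[OF continuous_on_extended_density that] zero_less_one that])
      (simp add: cdf)
  have "(extended_density \<longlongrightarrow> extended_density 0) (at_right 0)"
    using continuous_on_extended_density
    by (auto simp: continuous_on_def at_within_Icc_at_right dest: bspec[of _ _ 0])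
  moreover have "eventually (\<lambda>c. extended_density c = area_ratio_density c) (at_right 0)"
    using eventually_at_right_less by eventually_elim (rule extended_density_eq)
  ultimately have "(area_ratio_density \<longlongrightarrow> extended_density 0) (at_right 0)"
    using tendsto_cong by fastforce
  moreover have "((\<lambda>x. measure M {\<omega> \<in> space M. Q \<omega> \<le> x}) has_real_derivative area_ratio_density c)
      (at c within {0..1})" if "c \<in> {0<..1}" for c
    using deriv[of c] extended_density_eq[of c] that by simp
  ultimately show ?thesis
    using deriv[of 0] by (intro conjI ballI exI[of _ "extended_density 0"]) simp_all
qed

end
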